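(* Let $\Gamma$ be an infinite finitely generated discrete group having polynomial growth with growth exponent $r\ge 1$ (with respect to a word length function $\ell$), and let $\phi$ be an automorphism of $\Gamma$. Then $$h_{\mathrm{alg}}(\phi)\;\le\;\mathrm{Entp}(\phi)\;\le\; r\,h_{\mathrm{geo}}(\phi).$$
   Context: $\ell$ is the word length function on $\Gamma$ with respect to a fixed finite generating set. $\Gamma$ has polynomial growth with growth exponent $r\ge1$ if there is $C>0$ such that $|\{g\in\Gamma:\ell(g)\le n\}|\le C(1+n)^r$ for all $n\in\mathbb N$. $C^*_r(\Gamma)$ is the reduced group $C^*$-algebra with norm $\|\cdot\|_{\mathrm{red}}$, $C_c(\Gamma)$ is the dense $*$-subalgebra of finitely supported functions $\sum_{g} c_g\delta_g$ (with convolution product), and $C_c(\Gamma)_1=\{f\in C_c(\Gamma):\|f\|_{\mathrm{red}}\le 1\}$. An automorphism $\phi$ of $\Gamma$ induces an automorphism of $C^*_r(\Gamma)$, also denoted $\phi$, with $\phi(\sum c_g\delta_g)=\sum c_g\delta_{\phi(g)}$. For a subset $Y$ of a normed space $X$ and $\delta>0$, $D(Y,\delta)$ is the infimum of $\dim Z$ over finite-dimensional subspaces $Z\subseteq X$ such that for every $y\in Y$ there is $z\in Z$ with $\|y-z\|<\delta$. Product entropy: for finite $\Omega\subseteq C_c(\Gamma)_1$ and $\delta>0$, $\mathrm{Entp}(\phi,\Omega,\delta)=\limsup_{n\to\infty}\frac1n\log D\big(\Omega\,\phi(\Omega)\cdots\phi^{n-1}(\Omega),\delta\big)$ (set of all products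 $a_0a_1\cdots a_{n-1}$ with $a_i\in\phi^i(\Omega)$, in the normed space $C_r^*(\Gamma)$), and $\mathrm{Entp}(\phi)=\sup_{\Omega}\sup_{\delta>0}\mathrm{Entp}(\phi,\Omega,\delta)$, with $\Omega$ ranging over finite subsets of $C_c(\Gamma)_1$. Algebraic entropy: $h_{\mathrm{alg}}(\phi)=\sup_{F\subseteq\Gamma\text{ finite}}\limsup_{n\to\infty}\frac1n\log|F\,\phi(F)\cdots\phi^{n-1}(F)|$. Geometric entropy: $h_{\mathrm{geo}}(\phi)=\log\big(\sup_{g\in\Gamma}\limsup_{n\to\infty}\ell(\phi^n(g))^{1/n}\big)$. *)

theory Defs
  imports "HOL-Analysis.Analysis" "HOL-Algebra.Coset" "HOL-Algebra.Generated_Groups"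
begin

section \<open>The Hilbert space of square-summable functions\<close>

typedef 'a ell2 = "{f :: 'a \<Rightarrow> complex. (\<lambda>x. (norm (f x))\<^sup>2) summable_on UNIV}"
  by (rule exI[of _ "\<lambda>_. 0"]) simp

setup_lifting type_definition_ell2

lemma ell2_summable: "(\<lambda>x. (norm (Rep_ell2 f x))\<^sup>2) summable_on UNIV"
  using Rep_ell2[of f] by simp

lemma ell2_eqI: "(\<And>x. Rep_ell2 f x = Rep_ell2 g x) \<Longrightarrow> f = g"
  by (simp add: Rep_ell2_inject[symmetric] fun_eq_iff)

lemma ell2_inner_summable_aux:
  fixes f g :: "'a \<Rightarrow> complex"
  assumes "(\<lambda>x. (norm (f x))\<^sup>2) summable_on UNIV" "(\<lambda>x. (norm (g x))\<^sup>2) summable_on UNIV"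
  shows "(\<lambda>x. f x \<bullet> g x) summable_on UNIV"
proof -
  have s: "(\<lambda>x. (norm (f x))\<^sup>2 + (norm (g x))\<^sup>2) summable_on UNIV"
    by (intro summable_on_add assms)
  have "norm (f x \<bullet> g x) \<le> (norm (f x))\<^sup>2 + (norm (g x))\<^sup>2" for x
  proof -
    have "\<bar>f x \<bullet> g x\<bar> \<le> norm (f x) * norm (g x)" by (rule Cauchy_Schwarz_ineq2)
    also have "\<dots> \<le> (norm (f x))\<^sup>2 + (norm (g x))\<^sup>2"
      using sum_squares_bound[of "norm (f x)" "norm (g x)"]
        mult_nonneg_nonneg[OF norm_ge_zero[of "f x"] norm_ge_zero[of "g x"]] by linarith
    finally show ?thesis by simp
  qed
  then have "(\<lambda>x. norm (f x \<bullet> g x)) summable_on UNIV"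
    by (intro Infinite_Sum.abs_summable_on_comparison_test'[OF s])
  then show ?thesis by (rule Infinite_Sum.abs_summable_summable)
qed

lemma ell2_inner_summable: "(\<lambda>x. Rep_ell2 f x \<bullet> Rep_ell2 g x) summable_on UNIV"
  by (intro ell2_inner_summable_aux ell2_summable)

instantiation ell2 :: (type) real_vector
begin

lift_definition zero_ell2 :: "'a ell2" is "\<lambda>_. 0" by simp

lift_definition uminus_ell2 :: "'a ell2 \<Rightarrow> 'a ell2" is "\<lambda>f x. - f x" by simp

lift_definition plus_ell2 :: "'a ell2 \<Rightarrow> 'a ell2 \<Rightarrow> 'a ell2" is "\<lambda>f g x. f x + g x"
proof -
  fix f g :: "'a \<Rightarrow> complex"
  assume *: "(\<lambda>x. (norm (f x))\<^sup>2) summable_on UNIV" "(\<lambda>x. (norm (g x))\<^sup>2) summable_on UNIV"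
  have "(\<lambda>x. (norm (f x))\<^sup>2 + (norm (g x))\<^sup>2 + 2 * (f x \<bullet> g x)) summable_on UNIV"
    by (intro summable_on_add summable_on_cmult_right * ell2_inner_summable_aux)
  then show "(\<lambda>x. (norm (f x + g x))\<^sup>2) summable_on UNIV"
    by (simp add: power2_norm_eq_inner inner_add inner_commute algebra_simps)
qed

definition minus_ell2 :: "'a ell2 \<Rightarrow> 'a ell2 \<Rightarrow> 'a ell2"
  where "minus_ell2 f g = f + - g"

lift_definition scaleR_ell2 :: "real \<Rightarrow> 'a ell2 \<Rightarrow> 'a ell2" is "\<lambda>r f x. r *\<^sub>R f x"
  by (auto simp: power_mult_distrib intro: summable_on_cmult_right)

instance
  by standard (auto simp: Rep_ell2_inject[symmetric] fun_eq_iff minus_ell2_def plus_ell2.rep_eq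
      uminus_ell2.rep_eq zero_ell2.rep_eq scaleR_ell2.rep_eq scaleR_add_left scaleR_add_right)

end

instantiation ell2 :: (type) real_inner
begin

definition inner_ell2 :: "'a ell2 \<Rightarrow> 'a ell2 \<Rightarrow> real"
  where "inner_ell2 f g = (\<Sum>\<^sub>\<infinity>x. Rep_ell2 f x \<bullet> Rep_ell2 g x)"

definition norm_ell2 :: "'a ell2 \<Rightarrow> real"
  where "norm_ell2 f = sqrt (f \<bullet> f)"

definition sgn_ell2 :: "'a ell2 \<Rightarrow> 'a ell2"
  where "sgn_ell2 f = f /\<^sub>R norm f"

definition dist_ell2 :: "'a ell2 \<Rightarrow> 'a ell2 \<Rightarrow> real"
  where "dist_ell2 f g = norm (f - g)"

definition uniformity_ell2 :: "('a ell2 \<times> 'a ell2) filter"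
  where "uniformity_ell2 = (INF e\<in>{0<..}. principal {(x, y). dist x y < e})"

definition open_ell2 :: "'a ell2 set \<Rightarrow> bool"
  where "open_ell2 U = (\<forall>x\<in>U. \<forall>\<^sub>F (x', y) in uniformity. x' = x \<longrightarrow> y \<in> U)"

instance
proof
  fix f g h :: "'a ell2" and r :: real
  show "dist f g = norm (f - g)" by (fact dist_ell2_def)
  show "sgn f = f /\<^sub>R norm f" by (fact sgn_ell2_def)
  show "uniformity = (INF e\<in>{0<..}. principal {(x, y :: 'a ell2). dist x y < e})"
    by (fact uniformity_ell2_def)
  show "open U = (\<forall>x\<in>U. \<forall>\<^sub>F (x', y) in uniformity. x' = x \<longrightarrow> y \<in> U)" for U :: "'a ell2 set"
    by (fact open_ell2_def)
  show "f \<bullet> g = g \<bullet> f" by (simp add: inner_ell2_def inner_commute)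
  show "(f + g) \<bullet> h = f \<bullet> h + g \<bullet> h"
    by (simp add: inner_ell2_def plus_ell2.rep_eq inner_add_left infsum_add ell2_inner_summable)
  show "(r *\<^sub>R f) \<bullet> g = r * (f \<bullet> g)"
    by (simp add: inner_ell2_def scaleR_ell2.rep_eq infsum_cmult_right')
  show "0 \<le> f \<bullet> f" by (simp add: inner_ell2_def infsum_nonneg)
  show "f \<bullet> f = 0 \<longleftrightarrow> f = 0"
  proof
    assume "f \<bullet> f = 0"
    then have "Rep_ell2 f x \<bullet> Rep_ell2 f x = 0" for x
      using nonneg_infsum_le_0D[of "\<lambda>x. Rep_ell2 f x \<bullet> Rep_ell2 f x" UNIV x]
      by (simp add: inner_ell2_def ell2_inner_summable)
    then show "f = 0"
      by (simp add: Rep_ell2_inject[symmetric] fun_eq_iff zero_ell2.rep_eq)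
  qed (simp add: inner_ell2_def zero_ell2.rep_eq)
  show "norm f = sqrt (f \<bullet> f)" by (fact norm_ell2_def)
qed

end

lemma norm_ell2_eq: "norm f = sqrt (\<Sum>\<^sub>\<infinity>x. (norm (Rep_ell2 f x))\<^sup>2)"
  by (simp add: norm_ell2_def inner_ell2_def power2_norm_eq_inner)


section \<open>Complex scalars on bounded operators\<close>

text \<open>Operators are real-bounded-linear maps in the library; the complex structure comes from
  multiplying by a complex number on the Hilbert space.\<close>

lift_definition scaleC_ell2 :: "complex \<Rightarrow> 'a ell2 \<Rightarrow> 'a ell2" is "\<lambda>c f x. c * f x"
  by (auto simp: norm_mult power_mult_distrib intro: summable_on_cmult_right)

lemma norm_scaleC_ell2: "norm (scaleC_ell2 c f) = cmod c * norm f"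
  by (simp add: norm_ell2_eq scaleC_ell2.rep_eq norm_mult power_mult_distrib infsum_cmult_right'
      real_sqrt_mult)

lift_definition mult_op :: "complex \<Rightarrow> 'a ell2 \<Rightarrow>\<^sub>L 'a ell2" is scaleC_ell2
proof (rule bounded_linear_intro)
  fix c :: complex and f g :: "'a ell2" and r :: real
  show "scaleC_ell2 c (f + g) = scaleC_ell2 c f + scaleC_ell2 c g"
    by (rule ell2_eqI) (simp add: scaleC_ell2.rep_eq plus_ell2.rep_eq distrib_left)
  show "scaleC_ell2 c (r *\<^sub>R f) = r *\<^sub>R scaleC_ell2 c f"
    by (rule ell2_eqI) (simp add: scaleC_ell2.rep_eq scaleR_ell2.rep_eq)
  show "norm (scaleC_ell2 c f) \<le> norm f * cmod c"
    by (simp add: norm_scaleC_ell2)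
qed

definition scaleC_op :: "complex \<Rightarrow> ('a ell2 \<Rightarrow>\<^sub>L 'a ell2) \<Rightarrow> ('a ell2 \<Rightarrow>\<^sub>L 'a ell2)"
  where "scaleC_op c T = mult_op c o\<^sub>L T"

lemma scaleC_op_apply: "blinfun_apply (scaleC_op c T) \<xi> = scaleC_ell2 c (blinfun_apply T \<xi>)"
  by (simp add: scaleC_op_def mult_op.rep_eq)

global_interpretation op: vector_space scaleC_op
  defines op_subspace = op.subspace and op_span = op.span and op_dim = op.dim
proof
  fix a b :: complex and S T :: "'a ell2 \<Rightarrow>\<^sub>L 'a ell2"
  show "scaleC_op a (S + T) = scaleC_op a S + scaleC_op a T"
    by (rule blinfun_eqI)
      (simp add: scaleC_op_def blinfun.add_left blinfun.add_right)
  show "scaleC_op (a + b) T = scaleC_op a T + scaleC_op b T"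
    by (rule blinfun_eqI, rule ell2_eqI)
      (simp add: scaleC_op_apply blinfun.add_left scaleC_ell2.rep_eq plus_ell2.rep_eq distrib_right)
  show "scaleC_op a (scaleC_op b T) = scaleC_op (a * b) T"
    by (rule blinfun_eqI, rule ell2_eqI) (simp add: scaleC_op_apply scaleC_ell2.rep_eq)
  show "scaleC_op 1 T = T"
    by (rule blinfun_eqI, rule ell2_eqI) (simp add: scaleC_op_apply scaleC_ell2.rep_eq)
qed


section \<open>The reduced group C*-algebra\<close>

definition delta :: "'a \<Rightarrow> 'a \<Rightarrow> complex"
  where "delta g = (\<lambda>x. if x = g then 1 else 0)"

definition Cc :: "('a, 'b) monoid_scheme \<Rightarrow> ('a \<Rightarrow> complex) set"
  where "Cc G = {f. finite {g. f g \<noteq> 0} \<and> {g. f g \<noteq> 0} \<subseteq> carrier G}"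

definition conv :: "('a, 'b) monoid_scheme \<Rightarrow> ('a \<Rightarrow> complex) \<Rightarrow> ('a \<Rightarrow> complex) \<Rightarrow> 'a \<Rightarrow> complex"
  where "conv G f h = (\<lambda>x. if x \<in> carrier G
           then \<Sum>g | f g \<noteq> 0. f g * h (inv\<^bsub>G\<^esub> g \<otimes>\<^bsub>G\<^esub> x) else 0)"

text \<open>Left translation by an element of the group. The carrier need not exhaust the type, so the
  Hilbert space of the type is the orthogonal sum of that of the carrier and that of its complement;
  the operators below act by the left regular representation on the first summand and by zero on
  the second, which changes neither operator norms nor the algebraic structure. Since
  Abs_ell2 and Blinfun are only meaningful on square-summable functions and bounded linear maps,
  lemma left_translation_apply confirms that the definition is the intended one.\<close>

definition left_translation :: "('a, 'b) monoid_scheme \<Rightarrow> 'a \<Rightarrow> 'a ell2 \<Rightarrow>\<^sub>L 'a ell2"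
  where "left_translation G g = Blinfun (\<lambda>\<xi>. Abs_ell2 (\<lambda>x. if x \<in> carrier G
           then Rep_ell2 \<xi> (inv\<^bsub>G\<^esub> g \<otimes>\<^bsub>G\<^esub> x) else 0))"

definition left_regular :: "('a, 'b) monoid_scheme \<Rightarrow> ('a \<Rightarrow> complex) \<Rightarrow> 'a ell2 \<Rightarrow>\<^sub>L 'a ell2"
  where "left_regular G f = (\<Sum>g | f g \<noteq> 0. scaleC_op (f g) (left_translation G g))"

definition reduced_norm :: "('a, 'b) monoid_scheme \<Rightarrow> ('a \<Rightarrow> complex) \<Rightarrow> real"
  where "reduced_norm G f = norm (left_regular G f)"

definition reduced_Cstar :: "('a, 'b) monoid_scheme \<Rightarrow> ('a ell2 \<Rightarrow>\<^sub>L 'a ell2) set"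
  where "reduced_Cstar G = closure (left_regular G ` Cc G)"

definition Cc_unit_ball :: "('a, 'b) monoid_scheme \<Rightarrow> ('a \<Rightarrow> complex) set"
  where "Cc_unit_ball G = {f \<in> Cc G. reduced_norm G f \<le> 1}"

definition induced_aut :: "('a \<Rightarrow> 'a) \<Rightarrow> ('a \<Rightarrow> complex) \<Rightarrow> 'a \<Rightarrow> complex"
  where "induced_aut \<phi> f = (\<lambda>x. \<Sum>g | f g \<noteq> 0. f g * delta (\<phi> g) x)"

context group
begin

lemma left_translation_summable:
  assumes g: "g \<in> carrier G"
  shows "(\<lambda>x. (norm (if x \<in> carrier G then Rep_ell2 \<xi> (inv g \<otimes> x) else 0))\<^sup>2) summable_on UNIV"
    and "(\<Sum>\<^sub>\<infinity>x. (norm (if x \<in> carrier G then Rep_ell2 \<xi> (inv g \<otimes> x) else 0))\<^sup>2)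
           \<le> (norm \<xi>)\<^sup>2"
proof -
  let ?h = "\<lambda>x. (norm (Rep_ell2 \<xi> x))\<^sup>2"
  have bij: "bij_betw (\<lambda>x. inv g \<otimes> x) (carrier G) (carrier G)"
    by (rule bij_betwI[where g = "\<lambda>x. g \<otimes> x"]) (use g in \<open>auto simp: m_assoc[symmetric]\<close>)
  have s: "?h summable_on carrier G"
    using ell2_summable by (rule summable_on_subset_banach) simp
  then have s': "(\<lambda>x. ?h (inv g \<otimes> x)) summable_on carrier G"
    using summable_on_reindex_bij_betw[OF bij, of ?h] by simp
  show "(\<lambda>x. (norm (if x \<in> carrier G then Rep_ell2 \<xi> (inv g \<otimes> x) else 0))\<^sup>2) summable_on UNIV"
    by (rule summable_on_cong_neutral[THEN iffD1, OF _ _ _ s']) auto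
  have "(\<Sum>\<^sub>\<infinity>x. (norm (if x \<in> carrier G then Rep_ell2 \<xi> (inv g \<otimes> x) else 0))\<^sup>2)
      = (\<Sum>\<^sub>\<infinity>x\<in>carrier G. ?h (inv g \<otimes> x))"
    by (rule infsum_cong_neutral) auto
  also have "\<dots> = (\<Sum>\<^sub>\<infinity>x\<in>carrier G. ?h x)"
    by (rule infsum_reindex_bij_betw[OF bij])
  also have "\<dots> \<le> (\<Sum>\<^sub>\<infinity>x. ?h x)"
    by (rule infsum_mono2) (use s ell2_summable in auto)
  also have "\<dots> = (norm \<xi>)\<^sup>2"
    by (simp add: norm_ell2_eq infsum_nonneg)
  finally show "(\<Sum>\<^sub>\<infinity>x. (norm (if x \<in> carrier G then Rep_ell2 \<xi> (inv g \<otimes> x) else 0))\<^sup>2)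
           \<le> (norm \<xi>)\<^sup>2" .
qed

lemma left_translation_apply:
  assumes g: "g \<in> carrier G"
  shows "Rep_ell2 (blinfun_apply (left_translation G g) \<xi>) x
           = (if x \<in> carrier G then Rep_ell2 \<xi> (inv g \<otimes> x) else 0)"
proof -
  let ?L = "\<lambda>\<xi>. Abs_ell2 (\<lambda>x. if x \<in> carrier G then Rep_ell2 \<xi> (inv g \<otimes> x) else 0)"
  have R: "Rep_ell2 (?L \<xi>) = (\<lambda>x. if x \<in> carrier G then Rep_ell2 \<xi> (inv g \<otimes> x) else 0)" for \<xi>
    by (rule Abs_ell2_inverse) (use left_translation_summable(1)[OF g] in simp)
  have "bounded_linear ?L"
  proof (rule bounded_linear_intro)
    fix f h :: "'a ell2" and r :: real
    show "?L (f + h) = ?L f + ?L h"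
      by (simp add: Rep_ell2_inject[symmetric] R plus_ell2.rep_eq fun_eq_iff)
    show "?L (r *\<^sub>R f) = r *\<^sub>R ?L f"
      by (simp add: Rep_ell2_inject[symmetric] R scaleR_ell2.rep_eq fun_eq_iff)
    show "norm (?L f) \<le> norm f * 1"
      using left_translation_summable(2)[OF g, of f]
      by (simp add: norm_ell2_eq[of "?L f"] R real_le_lsqrt)
  qed
  then show ?thesis
    by (simp add: left_translation_def bounded_linear_Blinfun_apply R)
qed

lemma left_regular_apply:
  assumes f: "f \<in> Cc G"
  shows "Rep_ell2 (blinfun_apply (left_regular G f) \<xi>) = conv G f (Rep_ell2 \<xi>)"
proof
  fix x
  have sum: "Rep_ell2 (blinfun_apply (\<Sum>g\<in>A. T g) \<xi>) x = (\<Sum>g\<in>A. Rep_ell2 (blinfun_apply (T g) \<xi>) x)"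
    for A :: "'a set" and T :: "'a \<Rightarrow> 'a ell2 \<Rightarrow>\<^sub>L 'a ell2"
    by (induction A rule: infinite_finite_induct)
      (auto simp: blinfun.add_left plus_ell2.rep_eq zero_ell2.rep_eq)
  show "Rep_ell2 (blinfun_apply (left_regular G f) \<xi>) x = conv G f (Rep_ell2 \<xi>) x"
    using f unfolding left_regular_def sum conv_def Cc_def
    by (auto simp: scaleC_op_apply scaleC_ell2.rep_eq left_translation_apply subset_iff intro!: sum.neutral)
qed

end


section \<open>Product entropy\<close>

text \<open>The natural logarithm with value minus infinity at 0 and infinity at infinity.\<close>

definition ln_ereal :: "ereal \<Rightarrow> ereal"
  where "ln_ereal x = (if x \<le> 0 then -\<infinity> else if x = \<infinity> then \<infinity> else ereal (ln (real_of_ereal x)))"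

definition approx_dim ::
  "('a ell2 \<Rightarrow>\<^sub>L 'a ell2) set \<Rightarrow> ('a ell2 \<Rightarrow>\<^sub>L 'a ell2) set \<Rightarrow> real \<Rightarrow> enat"
  where "approx_dim X Y \<delta> =
    (INF Z \<in> {Z. op_subspace Z \<and> Z \<subseteq> X \<and> (\<exists>B. finite B \<and> Z = op_span B)
                \<and> (\<forall>y\<in>Y. \<exists>z\<in>Z. norm (y - z) < \<delta>)}. enat (op_dim Z))"

primrec conv_set_prod ::
  "('a, 'b) monoid_scheme \<Rightarrow> (nat \<Rightarrow> ('a \<Rightarrow> complex) set) \<Rightarrow> nat \<Rightarrow> ('a \<Rightarrow> complex) set"
  where
    "conv_set_prod G A 0 = {delta \<one>\<^bsub>G\<^esub>}"
  | "conv_set_prod G A (Suc n) = {conv G a b | a b. a \<in> conv_set_prod G A n \<and> b \<in> A n}"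

definition Entp_at ::
  "('a, 'b) monoid_scheme \<Rightarrow> ('a \<Rightarrow> 'a) \<Rightarrow> ('a \<Rightarrow> complex) set \<Rightarrow> real \<Rightarrow> ereal"
  where "Entp_at G \<phi> \<Omega> \<delta> = limsup (\<lambda>n. ereal (1 / real n) * ln_ereal (ereal_of_enat
    (approx_dim (reduced_Cstar G)
       (left_regular G ` conv_set_prod G (\<lambda>i. (induced_aut \<phi> ^^ i) ` \<Omega>) n) \<delta>)))"

definition Entp :: "('a, 'b) monoid_scheme \<Rightarrow> ('a \<Rightarrow> 'a) \<Rightarrow> ereal"
  where "Entp G \<phi> =
    (SUP \<Omega> \<in> {\<Omega>. finite \<Omega> \<and> \<Omega> \<subseteq> Cc_unit_ball G}. SUP \<delta> \<in> {0<..}. Entp_at G \<phi> \<Omega> \<delta>)"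


section \<open>Algebraic and geometric entropy\<close>

primrec set_prod :: "('a, 'b) monoid_scheme \<Rightarrow> (nat \<Rightarrow> 'a set) \<Rightarrow> nat \<Rightarrow> 'a set"
  where
    "set_prod G A 0 = {\<one>\<^bsub>G\<^esub>}"
  | "set_prod G A (Suc n) = set_prod G A n <#>\<^bsub>G\<^esub> A n"

definition h_alg :: "('a, 'b) monoid_scheme \<Rightarrow> ('a \<Rightarrow> 'a) \<Rightarrow> ereal"
  where "h_alg G \<phi> = (SUP F \<in> {F. finite F \<and> F \<subseteq> carrier G}.
    limsup (\<lambda>n. ereal (1 / real n) *
      ln_ereal (ereal (real (card (set_prod G (\<lambda>i. (\<phi> ^^ i) ` F) n))))))"

definition word_length :: "('a, 'b) monoid_scheme \<Rightarrow> 'a set \<Rightarrow> 'a \<Rightarrow> nat"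
  where "word_length G S g = (LEAST n. \<exists>ws. length ws = n \<and> set ws \<subseteq> S \<union> m_inv G ` S
    \<and> foldr (mult G) ws \<one>\<^bsub>G\<^esub> = g)"

definition polynomial_growth :: "('a, 'b) monoid_scheme \<Rightarrow> 'a set \<Rightarrow> real \<Rightarrow> bool"
  where "polynomial_growth G S r \<longleftrightarrow> (\<exists>C>0. \<forall>n.
    finite {g \<in> carrier G. word_length G S g \<le> n} \<and>
    real (card {g \<in> carrier G. word_length G S g \<le> n}) \<le> C * (1 + real n) powr r)"

definition h_geo :: "('a, 'b) monoid_scheme \<Rightarrow> 'a set \<Rightarrow> ('a \<Rightarrow> 'a) \<Rightarrow> ereal"
  where "h_geo G S \<phi> = ln_ereal (SUP g \<in> carrier G.
    limsup (\<lambda>n. ereal (root n (real (word_length G S ((\<phi> ^^ n) g))))))"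

end

theory Submission
  imports Defs "HOL-Real_Asymp.Real_Asymp"
begin

text \<open>
  Lower bound: for \<open>\<Omega> = {\<delta>\<^sub>g | g \<in> F}\<close> the products are the \<open>\<delta>\<^sub>x\<close> with
  \<open>x \<in> F \<phi>(F) \<dots> \<phi>\<^sup>n\<^sup>-\<^sup>1(F)\<close>. Evaluating operators at \<open>\<delta>\<^sub>1\<close> turns these into orthonormal
  vectors of \<open>\<ell>\<^sup>2\<close>; if \<open>N\<close> orthonormal vectors lie within \<open>\<delta>\<close> of a space of dimension \<open>d\<close>, the
  squared lengths of their projections sum to at most \<open>d\<close>, so \<open>(1 - \<delta>\<^sup>2) N \<le> d\<close>.

  Upper bound: if \<open>\<mu>\<close> exceeds all orbit growth rates, every product is supported in a ball of radius
  \<open>C n \<mu>\<^sup>n\<close>, whose cardinality bounds the dimension and grows at exponential rate at most \<open>r ln \<mu>\<close>.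
\<close>

section \<open>Orthonormal vectors near a finite-dimensional space\<close>

text \<open>With \<open>q\<close> the projection of \<open>u\<close> onto the span of the vectors
  \<open>e x\<close>, the difference of the two sides is
  \<open>(u - q) \<bullet> (u - q)\<close>.\<close>

lemma bessel_inequality:
  fixes e :: "'i \<Rightarrow> 'h::real_inner"
  assumes "finite E" and norm: "\<And>x. x \<in> E \<Longrightarrow> e x \<bullet> e x = 1"
    and orth: "\<And>x y. x \<in> E \<Longrightarrow> y \<in> E \<Longrightarrow> x \<noteq> y \<Longrightarrow> e x \<bullet> e y = 0"
  shows "(\<Sum>x\<in>E. (e x \<bullet> u)\<^sup>2) \<le> u \<bullet> u"
proof -
  define q where "q = (\<Sum>x\<in>E. (e x \<bullet> u) *\<^sub>R e x)"
  have eq: "e x \<bullet> q = e x \<bullet> u" if "x \<in> E" for x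
  proof -
    have "e x \<bullet> q = (\<Sum>y\<in>E. (e y \<bullet> u) * (e x \<bullet> e y))"
      by (simp add: q_def inner_sum_right)
    also have "\<dots> = (\<Sum>y\<in>E. if y = x then e x \<bullet> u else 0)"
      by (rule sum.cong) (use norm orth that in auto)
    finally show ?thesis using \<open>finite E\<close> that by simp
  qed
  have qu: "q \<bullet> u = (\<Sum>x\<in>E. (e x \<bullet> u)\<^sup>2)"
    by (simp add: q_def inner_sum_left power2_eq_square)
  have "q \<bullet> q = (\<Sum>x\<in>E. (e x \<bullet> u) * (e x \<bullet> q))"
    by (subst (1) q_def) (simp add: inner_sum_left)
  also have "\<dots> = (\<Sum>x\<in>E. (e x \<bullet> u)\<^sup>2)"
    by (rule sum.cong) (simp_all add: eq power2_eq_square)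
  finally have qq: "q \<bullet> q = (\<Sum>x\<in>E. (e x \<bullet> u)\<^sup>2)" .
  have "0 \<le> (u - q) \<bullet> (u - q)" by simp
  also have "\<dots> = u \<bullet> u - (\<Sum>x\<in>E. (e x \<bullet> u)\<^sup>2)"
    using qu qq by (simp add: inner_diff_left inner_diff_right inner_commute)
  finally show ?thesis by simp
qed

text \<open>The left-hand side is the squared distance from \<open>e\<close> to its projection
  \<open>p\<close> onto \<open>span C\<close>, and no point of the span is closer. The zero vector
  may belong to \<open>C\<close>: division by zero yields 0, so its term vanishes.\<close>

lemma norm_diff_span_ge:
  fixes e :: "'h::real_inner"
  assumes "finite C" and orth: "pairwise orthogonal C" and z: "z \<in> span C"
  shows "e \<bullet> e - (\<Sum>u\<in>C. (e \<bullet> u)\<^sup>2 / (u \<bullet> u)) \<le> (norm (e - z))\<^sup>2"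
proof -
  define p where "p = (\<Sum>u\<in>C. ((e \<bullet> u) / (u \<bullet> u)) *\<^sub>R u)"
  have pu: "p \<bullet> v = e \<bullet> v" if "v \<in> C" for v
  proof -
    have "p \<bullet> v = (\<Sum>u\<in>C. (e \<bullet> u) / (u \<bullet> u) * (u \<bullet> v))"
      by (simp add: p_def inner_sum_left)
    also have "\<dots> = (\<Sum>u\<in>C. if u = v then e \<bullet> v else 0)"
      by (rule sum.cong) (use orth that in \<open>auto simp: pairwise_def orthogonal_def\<close>)
    finally show ?thesis using \<open>finite C\<close> that by simp
  qed
  have perp: "orthogonal (e - p) y" if "y \<in> span C" for y
    by (rule orthogonal_to_span[OF that])
      (simp add: orthogonal_def inner_diff_left pu)
  have pspan: "p \<in> span C"
    unfolding p_def by (intro span_sum span_scale span_base)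
  have 1: "(e - p) \<bullet> p = 0" "(e - p) \<bullet> z = 0"
    using perp[OF pspan] perp[OF z] by (auto simp: orthogonal_def)
  have "e \<bullet> p = (\<Sum>u\<in>C. (e \<bullet> u)\<^sup>2 / (u \<bullet> u))"
    by (simp add: p_def inner_sum_right power2_eq_square)
  \<comment> \<open>Pythagoras for \<open>e - z = (e - p) + (p - z)\<close>, where
    \<open>e - p\<close> is orthogonal to both \<open>p\<close> and \<open>z\<close>.\<close>
  moreover have "(norm (e - z))\<^sup>2 = (e \<bullet> e - e \<bullet> p) + (p - z) \<bullet> (p - z)"
    using 1 by (simp add: power2_norm_eq_inner inner_diff_left inner_diff_right inner_commute)
  moreover have "0 \<le> (p - z) \<bullet> (p - z)" by simp
  ultimately show ?thesis by linarith
qed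

text \<open>Double counting of \<open>(e x \<bullet> u)\<^sup>2 / (u \<bullet> u)\<close> over
  \<open>E\<close> and an orthogonal spanning set \<open>C\<close>: for fixed \<open>x\<close> the
  sum is at least \<open>1 - \<delta>\<^sup>2\<close> by nearness, for fixed \<open>u\<close> at
  most 1 by Bessel.\<close>

lemma card_orthonormal_near_span:
  fixes e :: "'i \<Rightarrow> 'h::real_inner"
  assumes E: "finite E" and norm: "\<And>x. x \<in> E \<Longrightarrow> e x \<bullet> e x = 1"
    and orth: "\<And>x y. x \<in> E \<Longrightarrow> y \<in> E \<Longrightarrow> x \<noteq> y \<Longrightarrow> e x \<bullet> e y = 0"
    and B: "finite B"
    and near: "\<And>x. x \<in> E \<Longrightarrow> \<exists>z\<in>span B. norm (e x - z) < \<delta>"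
  shows "(1 - \<delta>\<^sup>2) * real (card E) \<le> real (card B)"
proof -
  obtain C where C: "finite C" "card C \<le> card B" "span C = span B" "pairwise orthogonal C"
    using basis_orthogonal[OF B] by blast
  have ge: "1 - \<delta>\<^sup>2 \<le> (\<Sum>u\<in>C. (e x \<bullet> u)\<^sup>2 / (u \<bullet> u))" if x: "x \<in> E" for x
  proof -
    obtain z where z: "z \<in> span C" "norm (e x - z) < \<delta>" using near[OF x] C by auto
    have "(norm (e x - z))\<^sup>2 \<le> \<delta>\<^sup>2"
      using z by (intro power_mono) auto
    with norm_diff_span_ge[OF C(1,4) z(1), of "e x"] norm[OF x] show ?thesis by linarith
  qed
  have le: "(\<Sum>x\<in>E. (e x \<bullet> u)\<^sup>2 / (u \<bullet> u)) \<le> 1" for u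
    using bessel_inequality[OF E norm orth, where u = u]
    by (cases "u = 0") (simp_all add: sum_divide_distrib[symmetric] divide_le_eq)
  have "(1 - \<delta>\<^sup>2) * real (card E) = (\<Sum>x\<in>E. 1 - \<delta>\<^sup>2)" by simp
  also have "\<dots> \<le> (\<Sum>x\<in>E. \<Sum>u\<in>C. (e x \<bullet> u)\<^sup>2 / (u \<bullet> u))" by (intro sum_mono ge)
  also have "\<dots> = (\<Sum>u\<in>C. \<Sum>x\<in>E. (e x \<bullet> u)\<^sup>2 / (u \<bullet> u))" by (rule sum.swap)
  also have "\<dots> \<le> (\<Sum>u\<in>C. 1)" by (intro sum_mono le)
  also have "\<dots> \<le> real (card B)" using C by simp
  finally show ?thesis .
qed


section \<open>Word length\<close>

context group
begin

lemma foldr_mult_append: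
  assumes "set ws \<subseteq> carrier G" "set vs \<subseteq> carrier G"
  shows "foldr (\<otimes>) (ws @ vs) \<one> = foldr (\<otimes>) ws \<one> \<otimes> foldr (\<otimes>) vs \<one>"
proof -
  have closed: "foldr (\<otimes>) us \<one> \<in> carrier G" if "set us \<subseteq> carrier G" for us
    using that by (induction us) auto
  show ?thesis
    using assms by (induction ws) (auto simp: closed m_assoc)
qed

text \<open>Guarantees that the \<open>LEAST\<close> in \<open>word_length\<close> ranges over a
  nonempty set, so that a shortest word exists.\<close>

lemma generate_word:
  assumes S: "S \<subseteq> carrier G" and "g \<in> generate G S"
  shows "\<exists>ws. set ws \<subseteq> S \<union> m_inv G ` S \<and> foldr (\<otimes>) ws \<one> = g"
  using assms(2)
proof induction
  case one
  show ?case by (rule exI[of _ "[]"]) simp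
next
  case (incl h)
  then show ?case using S by (intro exI[of _ "[h]"]) auto
next
  case (inv h)
  then show ?case using S by (intro exI[of _ "[inv h]"]) auto
next
  case (eng h1 h2)
  then obtain ws vs where
    "set ws \<subseteq> S \<union> m_inv G ` S" "foldr (\<otimes>) ws \<one> = h1"
    "set vs \<subseteq> S \<union> m_inv G ` S" "foldr (\<otimes>) vs \<one> = h2" by blast
  moreover have "S \<union> m_inv G ` S \<subseteq> carrier G" using S by auto
  ultimately show ?case
    using foldr_mult_append[of ws vs] by (intro exI[of _ "ws @ vs"]) auto
qed

lemma word_length_le:
  assumes "set ws \<subseteq> S \<union> m_inv G ` S" "foldr (\<otimes>) ws \<one> = g"
  shows "word_length G S g \<le> length ws"
  unfolding word_length_def by (rule Least_le) (use assms in blast)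

lemma word_length_witness:
  assumes "S \<subseteq> carrier G" "g \<in> generate G S"
  obtains ws where "length ws = word_length G S g" "set ws \<subseteq> S \<union> m_inv G ` S"
    "foldr (\<otimes>) ws \<one> = g"
proof -
  have "\<exists>ws. length ws = word_length G S g \<and> set ws \<subseteq> S \<union> m_inv G ` S \<and> foldr (\<otimes>) ws \<one> = g"
    unfolding word_length_def
    by (rule LeastI_ex) (use generate_word[OF assms] in blast)
  then show ?thesis using that by blast
qed

lemma word_length_one: "word_length G S \<one> = 0"
  using word_length_le[of "[]" S \<one>] by simp

lemma word_length_mult:
  assumes S: "S \<subseteq> carrier G" and g: "g \<in> generate G S" and h: "h \<in> generate G S"
  shows "word_length G S (g \<otimes> h) \<le> word_length G S g + word_length G S h"
proof -
  obtain ws where ws: "length ws = word_length G S g" "set ws \<subseteq> S \<union> m_inv G ` S"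
    "foldr (\<otimes>) ws \<one> = g" using word_length_witness[OF S g] .
  obtain vs where vs: "length vs = word_length G S h" "set vs \<subseteq> S \<union> m_inv G ` S"
    "foldr (\<otimes>) vs \<one> = h" using word_length_witness[OF S h] .
  have "S \<union> m_inv G ` S \<subseteq> carrier G" using S by auto
  then have "foldr (\<otimes>) (ws @ vs) \<one> = g \<otimes> h"
    using foldr_mult_append[of ws vs] ws vs by auto
  then show ?thesis using word_length_le[of "ws @ vs" S "g \<otimes> h"] ws vs by auto
qed

text \<open>The empty word represents only the identity. This later forces the orbit growth rate of
  a nontrivial element to be at least 1.\<close>

lemma word_length_pos:
  assumes "S \<subseteq> carrier G" "g \<in> generate G S" "g \<noteq> \<one>"
  shows "1 \<le> word_length G S g"
proof -
  obtain ws where "length ws = word_length G S g" "foldr (\<otimes>) ws \<one> = g"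
    using word_length_witness[OF assms(1,2)] .
  with assms(3) show ?thesis by (cases ws) auto
qed


section \<open>Supports of convolution products\<close>

text \<open>A nonzero convolution value has a nonzero summand, at some \<open>g\<close>; its second
  factor is evaluated at \<open>inv g \<otimes> x\<close>, which serves as \<open>k\<close>.\<close>

lemma support_conv:
  assumes f: "{g. f g \<noteq> 0} \<subseteq> carrier G" and x: "conv G f h x \<noteq> 0"
  obtains g k where "g \<in> carrier G" "k \<in> carrier G" "f g \<noteq> 0" "h k \<noteq> 0" "x = g \<otimes> k"
proof -
  have xG: "x \<in> carrier G" using x by (auto simp: conv_def split: if_splits)
  have "(\<Sum>g | f g \<noteq> 0. f g * h (inv g \<otimes> x)) \<noteq> 0"
    using x xG by (simp add: conv_def)
  then obtain g where g: "f g \<noteq> 0" "h (inv g \<otimes> x) \<noteq> 0"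
    by (rule sum.not_neutral_contains_not_neutral) auto
  then have "g \<in> carrier G" using f by auto
  then show ?thesis
    using that[of g "inv g \<otimes> x"] g xG by (simp add: m_assoc[symmetric])
qed

text \<open>Word length is subadditive, so the radii of balls containing the supports of the factors
  add up along a product.\<close>

lemma support_conv_set_prod:
  assumes S: "S \<subseteq> carrier G" and gen: "generate G S = carrier G"
    and A: "\<And>i f. f \<in> A i \<Longrightarrow> {g. f g \<noteq> 0} \<subseteq> {g \<in> carrier G. word_length G S g \<le> R i}"
    and f: "f \<in> conv_set_prod G A n"
  shows "{g. f g \<noteq> 0} \<subseteq> {g \<in> carrier G. word_length G S g \<le> (\<Sum>i<n. R i)}"
  using f
proof (induction n arbitrary: f)
  case 0
  then show ?case by (auto simp: delta_def word_length_one split: if_splits)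
next
  case (Suc n)
  then obtain a b where ab: "a \<in> conv_set_prod G A n" "b \<in> A n" "f = conv G a b" by auto
  note IH = Suc.IH[OF ab(1)] and b = A[OF ab(2)]
  show ?case
  proof
    fix x assume "x \<in> {g. f g \<noteq> 0}"
    then have "conv G a b x \<noteq> 0" using ab by simp
    then obtain g k where gk: "g \<in> carrier G" "k \<in> carrier G" "a g \<noteq> 0" "b k \<noteq> 0" "x = g \<otimes> k"
      using support_conv[of a b x] IH by blast
    have "word_length G S x \<le> word_length G S g + word_length G S k"
      using gk word_length_mult[OF S] gen by simp
    also have "\<dots> \<le> (\<Sum>i<n. R i) + R n" using gk IH b by (intro add_mono) auto
    finally show "x \<in> {g \<in> carrier G. word_length G S g \<le> (\<Sum>i<Suc n. R i)}"
      using gk by simp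
  qed
qed

lemma conv_delta:
  assumes "g \<in> carrier G" "h \<in> carrier G"
  shows "conv G (delta g) (delta h) = delta (g \<otimes> h)"
proof
  fix x
  have "{k. delta g k \<noteq> 0} = {g}" by (auto simp: delta_def)
  then show "conv G (delta g) (delta h) x = delta (g \<otimes> h) x"
    using assms inv_solve_left[of h g x] by (auto simp: conv_def delta_def)
qed

text \<open>Point masses convolve as group elements multiply; this translates the products in the
  definition of \<open>Entp\<close> into those in the definition of \<open>h_alg\<close>.\<close>

lemma conv_set_prod_delta:
  assumes "\<And>i. A i \<subseteq> carrier G"
  shows "set_prod G A n \<subseteq> carrier G"
    and "conv_set_prod G (\<lambda>i. delta ` A i) n = delta ` set_prod G A n"
proof -
  show *: "set_prod G A n \<subseteq> carrier G" for n
    by (induction n) (use assms in \<open>auto simp: set_mult_def\<close>)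
  show "conv_set_prod G (\<lambda>i. delta ` A i) n = delta ` set_prod G A n"
  proof (induction n)
    case (Suc n)
    have "conv G (delta g) (delta h) = delta (g \<otimes> h)" if "g \<in> set_prod G A n" "h \<in> A n" for g h
      using that * assms by (intro conv_delta) auto
    then have "conv_set_prod G (\<lambda>i. delta ` A i) (Suc n)
        = {delta (g \<otimes> h) | g h. g \<in> set_prod G A n \<and> h \<in> A n}"
      by (auto simp: Suc) (metis imageI)+
    also have "\<dots> = delta ` set_prod G A (Suc n)" by (auto simp: set_mult_def)
    finally show ?case .
  qed simp
qed

end

section \<open>The induced automorphism on supports and point masses\<close>

lemma support_induced_aut_funpow:
  "{x. (induced_aut \<phi> ^^ i) f x \<noteq> 0} \<subseteq> (\<phi> ^^ i) ` {x. f x \<noteq> 0}"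
proof (induction i)
  case 0
  show ?case by simp
next
  case (Suc i)
  \<comment> \<open>Only an inclusion: with \<open>\<phi>\<close> arbitrary, coefficients over one
    fibre may cancel.\<close>
  have "{x. induced_aut \<phi> h x \<noteq> 0} \<subseteq> \<phi> ` {x. h x \<noteq> 0}" for h
  proof
    fix x assume "x \<in> {x. induced_aut \<phi> h x \<noteq> 0}"
    then have "(\<Sum>g | h g \<noteq> 0. h g * delta (\<phi> g) x) \<noteq> 0"
      by (simp add: induced_aut_def)
    then obtain g where "h g \<noteq> 0" "delta (\<phi> g) x \<noteq> 0"
      by (rule sum.not_neutral_contains_not_neutral) auto
    then show "x \<in> \<phi> ` {x. h x \<noteq> 0}" by (auto simp: delta_def split: if_splits)
  qed
  from subset_trans[OF this image_mono[OF Suc.IH]] show ?case by (simp add: image_comp comp_def)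
qed

lemma induced_aut_delta: "(induced_aut \<phi> ^^ i) (delta g) = delta ((\<phi> ^^ i) g)"
proof (induction i)
  case (Suc i)
  have "{k. delta g k \<noteq> 0} = {g}" for g :: 'a by (auto simp: delta_def)
  then have "induced_aut \<phi> (delta g) = delta (\<phi> g)" for g
    by (auto simp: induced_aut_def delta_def)
  with Suc show ?case by simp
qed simp


section \<open>Approximation dimension\<close>

text \<open>Points outside the support contribute zero. Functions with different supports can thus
  be expanded over one index set.\<close>

lemma left_regular_superset:
  assumes "finite B" "{g. f g \<noteq> 0} \<subseteq> B"
  shows "left_regular G f = (\<Sum>g\<in>B. scaleC_op (f g) (left_translation G g))"
  unfolding left_regular_def using assms by (intro sum.mono_neutral_left) auto

lemma left_regular_delta: "left_regular G (delta g) = left_translation G g"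
  using left_regular_superset[of "{g}" "delta g" G] by (auto simp: delta_def)

text \<open>Places spans of left translations inside \<open>reduced_Cstar G\<close>, as required of
  the approximating spaces in \<open>approx_dim\<close>.\<close>

lemma op_subspace_left_regular: "op_subspace (left_regular G ` Cc G)"
proof (rule op.subspaceI)
  show "0 \<in> left_regular G ` Cc G"
    by (rule image_eqI[of _ _ "\<lambda>_. 0"]) (auto simp: left_regular_def Cc_def)
next
  fix x y assume "x \<in> left_regular G ` Cc G" "y \<in> left_regular G ` Cc G"
  then obtain f h where fh: "f \<in> Cc G" "h \<in> Cc G" "x = left_regular G f" "y = left_regular G h"
    by auto
  let ?B = "{g. f g \<noteq> 0} \<union> {g. h g \<noteq> 0}"
  have B: "finite ?B" "?B \<subseteq> carrier G" using fh by (auto simp: Cc_def)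
  have s: "{g. f g + h g \<noteq> 0} \<subseteq> ?B" by auto
  have "x + y = left_regular G (\<lambda>g. f g + h g)"
    using left_regular_superset[OF B(1), of f G] left_regular_superset[OF B(1), of h G]
      left_regular_superset[OF B(1) s, of G]
    by (simp add: fh op.scale_left_distrib sum.distrib)
  moreover have "(\<lambda>g. f g + h g) \<in> Cc G"
    using finite_subset[OF s B(1)] s B(2) by (auto simp: Cc_def)
  ultimately show "x + y \<in> left_regular G ` Cc G" by blast
next
  fix c x assume "x \<in> left_regular G ` Cc G"
  then obtain f where f: "f \<in> Cc G" "x = left_regular G f" by auto
  let ?B = "{g. f g \<noteq> 0}"
  have B: "finite ?B" "?B \<subseteq> carrier G" using f by (auto simp: Cc_def)
  have s: "{g. c * f g \<noteq> 0} \<subseteq> ?B" by auto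
  have "scaleC_op c x = left_regular G (\<lambda>g. c * f g)"
    unfolding f left_regular_superset[OF B(1) s]
    by (simp add: left_regular_def op.scale_sum_right)
  moreover have "(\<lambda>g. c * f g) \<in> Cc G"
    using finite_subset[OF s B(1)] s B(2) by (auto simp: Cc_def)
  ultimately show "scaleC_op c x \<in> left_regular G ` Cc G" by blast
qed

text \<open>The span of the left translations by \<open>B\<close> contains every operator to be
  approximated, so it serves with error 0 for any positive \<open>\<delta>\<close>.\<close>

lemma approx_dim_le:
  assumes B: "finite B" "B \<subseteq> carrier G" and \<delta>: "0 < \<delta>"
    and Y: "\<And>f. f \<in> Y \<Longrightarrow> {g. f g \<noteq> 0} \<subseteq> B"
  shows "approx_dim (reduced_Cstar G) (left_regular G ` Y) \<delta> \<le> enat (card B)"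
proof -
  let ?Z = "op_span (left_translation G ` B)"
  have "left_translation G g \<in> left_regular G ` Cc G" if "g \<in> B" for g
    by (rule image_eqI[of _ _ "delta g"], simp add: left_regular_delta)
      (use that B in \<open>auto simp: Cc_def delta_def\<close>)
  then have "?Z \<subseteq> left_regular G ` Cc G"
    by (intro op.span_minimal op_subspace_left_regular) auto
  also have "\<dots> \<subseteq> reduced_Cstar G"
    unfolding reduced_Cstar_def by (rule closure_subset)
  finally have sub: "?Z \<subseteq> reduced_Cstar G" .
  have "left_regular G f \<in> ?Z" if "f \<in> Y" for f
    unfolding left_regular_superset[OF B(1) Y[OF that]]
    by (intro op.span_sum op.span_scale op.span_base) auto
  then have near: "\<forall>y\<in>left_regular G ` Y. \<exists>z\<in>?Z. norm (y - z) < \<delta>"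
    using \<delta> by (metis (no_types, lifting) diff_self imageE norm_zero)
  have "op_dim ?Z \<le> card (left_translation G ` B)"
    by (rule op.dim_le_card) (use B in auto)
  also have "\<dots> \<le> card B" using B by (intro card_image_le)
  finally have "enat (op_dim ?Z) \<le> enat (card B)" by simp
  then show ?thesis
    unfolding approx_dim_def
    by (intro INF_lower2[of ?Z]) (use sub near B in \<open>auto intro!: exI[of _ "left_translation G ` B"]\<close>)
qed

section \<open>Lower bound for the approximation dimension of point masses\<close>

lift_definition ell2_delta :: "'a \<Rightarrow> 'a ell2" is delta
proof -
  fix g :: 'a
  have "(\<lambda>x. (cmod (delta g x))\<^sup>2) summable_on UNIV \<longleftrightarrow> (\<lambda>x. (cmod (delta g x))\<^sup>2) summable_on {g}"
    by (rule summable_on_cong_neutral) (auto simp: delta_def)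
  then show "(\<lambda>x. (cmod (delta g x))\<^sup>2) summable_on UNIV" by simp
qed

lemma inner_ell2_delta: "ell2_delta g \<bullet> ell2_delta h = (if g = h then 1 else 0)"
proof -
  have "ell2_delta g \<bullet> ell2_delta h = (\<Sum>\<^sub>\<infinity>x\<in>{g}. delta g x \<bullet> delta h x)"
    unfolding inner_ell2_def ell2_delta.rep_eq
    by (rule infsum_cong_neutral) (auto simp: delta_def)
  then show ?thesis by (simp add: delta_def inner_complex_def)
qed

lemma (in group) left_translation_ell2_delta:
  assumes "g \<in> carrier G"
  shows "blinfun_apply (left_translation G g) (ell2_delta \<one>) = ell2_delta g"
proof (rule ell2_eqI)
  fix x
  show "Rep_ell2 (blinfun_apply (left_translation G g) (ell2_delta \<one>)) x = Rep_ell2 (ell2_delta g) x"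
    unfolding left_translation_apply[OF assms] ell2_delta.rep_eq
    using assms inv_solve_left[of \<one> g x] by (auto simp: delta_def)
qed

text \<open>Left translations are contractions, which makes finite sets of point masses admissible
  choices of \<open>\<Omega>\<close> in \<open>Entp\<close>.\<close>

lemma (in group) reduced_norm_delta_le:
  assumes "g \<in> carrier G"
  shows "reduced_norm G (delta g) \<le> 1"
  unfolding reduced_norm_def left_regular_delta
proof (rule norm_blinfun_bound)
  fix \<xi> :: "'a ell2"
  have "norm (blinfun_apply (left_translation G g) \<xi>) \<le> norm \<xi>"
    using left_translation_summable(2)[OF assms, of \<xi>]
    by (simp add: norm_ell2_eq[of "blinfun_apply _ _"] left_translation_apply[OF assms] real_le_lsqrt)
  then show "norm (blinfun_apply (left_translation G g) \<xi>) \<le> 1 * norm \<xi>" by simp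
qed simp

text \<open>Bridges complex spans of operators and the real inner product used for the
  orthonormality estimate: each complex generator gives two real ones, a vector and its multiple by
  \<open>\<i>\<close>.\<close>

lemma op_span_apply:
  assumes B: "finite B" and T: "T \<in> op_span B"
  shows "blinfun_apply T \<xi> \<in>
    span ((\<lambda>b. blinfun_apply b \<xi>) ` B \<union> (\<lambda>b. scaleC_ell2 \<i> (blinfun_apply b \<xi>)) ` B)"
    (is "_ \<in> span ?V")
proof -
  obtain u where u: "T = (\<Sum>b\<in>B. scaleC_op (u b) b)"
    using T unfolding op.span_finite[OF B] by auto
  have split: "scaleC_ell2 c \<eta> = Re c *\<^sub>R \<eta> + Im c *\<^sub>R scaleC_ell2 \<i> \<eta>" for c and \<eta> :: "'a ell2"
    by (rule ell2_eqI)
      (simp add: scaleC_ell2.rep_eq plus_ell2.rep_eq scaleR_ell2.rep_eq complex_eq_iff)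
  have "blinfun_apply (scaleC_op (u b) b) \<xi> \<in> span ?V" if "b \<in> B" for b
    unfolding scaleC_op_apply by (subst split, intro span_add span_scale span_base) (use that in auto)
  then show ?thesis
    unfolding u blinfun.sum_left by (intro span_sum)
qed

text \<open>Evaluating an approximating space of complex dimension \<open>d\<close> at
  \<open>ell2_delta \<one>\<close> gives vectors in a real span of at most \<open>2 * d\<close>
  generators, within 1/2 of \<open>card E\<close> orthonormal vectors. Hence
  \<open>3/4 * card E \<le> 2 * d\<close>, and 4 is a convenient integer above 8/3.\<close>

lemma (in group) approx_dim_delta_ge:
  assumes E: "finite E" "E \<subseteq> carrier G"
  shows "enat (card E) \<le> 4 * approx_dim X (left_regular G ` delta ` E) (1/2)"
proof -
  have *: "real (card E) \<le> 4 * real (op_dim Z)"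
    if Z: "op_subspace Z" "finite B0" "Z = op_span B0"
      "\<forall>y\<in>left_regular G ` delta ` E. \<exists>z\<in>Z. norm (y - z) < 1/2" for Z B0
  proof -
    \<comment> \<open>The spanning set \<open>B0\<close> may have more than \<open>op_dim Z\<close>
      elements, so a basis replaces it; independence within the span of the finite \<open>B0\<close>
      makes the basis finite.\<close>
    obtain B where B: "B \<subseteq> Z" "\<not> op.dependent B" "Z \<subseteq> op_span B" "card B = op_dim Z"
      using op.basis_exists[of Z] by blast
    have fB: "finite B" using op.independent_span_bound[OF Z(2) B(2)] B(1) Z(3) by auto
    let ?V = "(\<lambda>b. blinfun_apply b (ell2_delta \<one>)) ` B \<union>
      (\<lambda>b. scaleC_ell2 \<i> (blinfun_apply b (ell2_delta \<one>))) ` B"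
    have "\<exists>z\<in>span ?V. norm (ell2_delta x - z) < 1/2" if x: "x \<in> E" for x
    proof -
      obtain T where T: "T \<in> Z" "norm (left_translation G x - T) < 1/2"
        using Z(4) x by (auto simp: left_regular_delta)
      have "norm (blinfun_apply (left_translation G x - T) (ell2_delta \<one>))
          \<le> norm (left_translation G x - T) * norm (ell2_delta \<one>)"
        by (rule norm_blinfun)
      also have "norm (ell2_delta \<one>) = 1" by (simp add: norm_eq_sqrt_inner inner_ell2_delta)
      finally have "norm (ell2_delta x - blinfun_apply T (ell2_delta \<one>)) < 1/2"
        using T(2) x E left_translation_ell2_delta[of x] by (auto simp: blinfun.diff_left)
      then show ?thesis using op_span_apply[OF fB, of T] T B by blast
    qed
    then have "(1 - (1/2)\<^sup>2) * real (card E) \<le> real (card ?V)"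
      using fB by (intro card_orthonormal_near_span[OF E(1)]) (auto simp: inner_ell2_delta)
    moreover have "card ?V \<le> card B + card B"
      using fB by (intro order_trans[OF card_Un_le] add_mono card_image_le)
    ultimately show ?thesis using B(4) by (simp add: power2_eq_square)
  qed
  show ?thesis
  proof (cases "approx_dim X (left_regular G ` delta ` E) (1/2)")
    case (enat d)
    \<comment> \<open>A finite value excludes an empty family, whose infimum is infinite; a nonempty
      family attains its infimum because \<open>enat\<close> is well ordered.\<close>
    let ?\<Z> = "{Z. op_subspace Z \<and> Z \<subseteq> X \<and> (\<exists>B. finite B \<and> Z = op_span B)
                \<and> (\<forall>y\<in>left_regular G ` delta ` E. \<exists>z\<in>Z. norm (y - z) < 1/2)}"
    have "?\<Z> \<noteq> {}"
    proof
      assume "?\<Z> = {}"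
      then have "approx_dim X (left_regular G ` delta ` E) (1/2) = \<infinity>"
        unfolding approx_dim_def by (simp only: image_empty Inf_empty top_enat_def)
      with enat show False by simp
    qed
    then obtain Z1 where "Z1 \<in> ?\<Z>" by blast
    then have "approx_dim X (left_regular G ` delta ` E) (1/2) \<in> (\<lambda>Z. enat (op_dim Z)) ` ?\<Z>"
      unfolding approx_dim_def by (rule wellorder_InfI[OF imageI])
    then obtain Z B0 where "op_subspace Z" "finite B0" "Z = op_span B0" "op_dim Z = d"
      "\<forall>y\<in>left_regular G ` delta ` E. \<exists>z\<in>Z. norm (y - z) < 1/2"
      using enat by auto
    with *[of Z B0] have "card E \<le> 4 * d" by simp
    then show ?thesis by (simp add: enat numeral_eq_enat)
  qed (simp add: numeral_eq_enat)
qed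


section \<open>The two inequalities\<close>

lemma ln_ereal_mono: "x \<le> y \<Longrightarrow> ln_ereal x \<le> ln_ereal y"
  by (cases x; cases y) (auto simp: ln_ereal_def)

lemma ln_ereal_mult:
  assumes "0 < c" "0 \<le> x"
  shows "ln_ereal (ereal c * x) = ereal (ln c) + ln_ereal x"
  using assms by (cases x) (auto simp: ln_ereal_def ln_mult zero_less_mult_iff mult_le_0_iff)

lemma limsup_le_limsup_add_null:
  fixes u v :: "nat \<Rightarrow> ereal" and w :: "nat \<Rightarrow> real"
  assumes "\<And>n. 0 < n \<Longrightarrow> u n \<le> ereal (w n) + v n" "w \<longlonglongrightarrow> 0"
  shows "limsup u \<le> limsup v"
proof -
  have "limsup u \<le> limsup (\<lambda>n. ereal (w n) + v n)"
    by (rule Limsup_mono, rule eventually_mono[OF eventually_gt_at_top[of 0]]) (rule assms(1))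
  also have "\<dots> = 0 + limsup v"
    by (rule ereal_limsup_lim_add) (use assms(2) in \<open>auto simp: zero_ereal_def\<close>)
  finally show ?thesis by simp
qed

text \<open>One test pair per \<open>F\<close> suffices: the point masses of \<open>F\<close> with
  tolerance 1/2. The factor 4 from \<open>approx_dim_delta_ge\<close> contributes only
  \<open>ln 4 / n\<close>, which tends to 0.\<close>

lemma (in group) h_alg_le_Entp:
  assumes \<phi>: "\<phi> \<in> carrier G \<rightarrow> carrier G"
  shows "h_alg G \<phi> \<le> Entp G \<phi>"
  unfolding h_alg_def
proof (rule SUP_least)
  fix F assume "F \<in> {F. finite F \<and> F \<subseteq> carrier G}"
  then have F: "finite F" "F \<subseteq> carrier G" by auto
  define A where "A i = (\<phi> ^^ i) ` F" for i
  have A: "A i \<subseteq> carrier G" for i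
    unfolding A_def using \<phi> F(2) by (induction i) auto
  have fin: "finite (set_prod G A n)" for n
    by (induction n) (auto simp: set_mult_def A_def F)
  let ?E = "set_prod G A"
  let ?D = "\<lambda>n. ereal_of_enat (approx_dim (reduced_Cstar G) (left_regular G ` delta ` ?E n) (1/2))"
  have ball: "delta ` F \<subseteq> Cc_unit_ball G"
    using F(2) by (auto simp: Cc_unit_ball_def Cc_def delta_def split: if_splits
        intro!: reduced_norm_delta_le[unfolded delta_def])
  have conv: "conv_set_prod G (\<lambda>i. (induced_aut \<phi> ^^ i) ` delta ` F) n = delta ` ?E n" for n
    using conv_set_prod_delta(2)[of A n, OF A] by (simp add: A_def image_image induced_aut_delta)
  have "ereal (1 / real n) * ln_ereal (ereal (real (card (?E n))))
      \<le> ereal (ln 4 / real n) + ereal (1 / real n) * ln_ereal (?D n)" if n: "0 < n" for n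
  proof -
    have "ereal_of_enat (enat (card (?E n))) \<le> ereal_of_enat
        (4 * approx_dim (reduced_Cstar G) (left_regular G ` delta ` ?E n) (1/2))"
      using approx_dim_delta_ge[OF fin conv_set_prod_delta(1)[of A, OF A], where X = "reduced_Cstar G"]
      unfolding ereal_of_enat_le_iff .
    then have "ereal (real (card (?E n))) \<le> ereal 4 * ?D n"
      by (simp add: ereal_of_enat_mult numeral_eq_enat)
    then have "ln_ereal (ereal (real (card (?E n)))) \<le> ereal (ln 4) + ln_ereal (?D n)"
      by (simp add: ln_ereal_mult[symmetric] ln_ereal_mono ereal_of_enat_nonneg)
    then have "ereal (1 / real n) * ln_ereal (ereal (real (card (?E n))))
        \<le> ereal (1 / real n) * (ereal (ln 4) + ln_ereal (?D n))"
      by (intro ereal_mult_left_mono) auto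
    also have "\<dots> = ereal (ln 4 / real n) + ereal (1 / real n) * ln_ereal (?D n)"
      using n by (cases "ln_ereal (?D n)") (auto simp: field_simps)
    finally show ?thesis .
  qed
  moreover have "(\<lambda>n. ln 4 / real n) \<longlonglongrightarrow> 0" by real_asymp
  ultimately have "limsup (\<lambda>n. ereal (1 / real n) * ln_ereal (ereal (real (card (?E n)))))
      \<le> limsup (\<lambda>n. ereal (1 / real n) * ln_ereal (?D n))"
    by (rule limsup_le_limsup_add_null)
  also have "\<dots> = Entp_at G \<phi> (delta ` F) (1/2)"
    unfolding Entp_at_def conv ..
  also have "\<dots> \<le> Entp G \<phi>"
    unfolding Entp_def using F(1) ball
    by (intro SUP_upper2[of "delta ` F"] SUP_upper2[of "1/2::real"]) auto
  finally show "limsup (\<lambda>n. ereal (1 / real n) *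
      ln_ereal (ereal (real (card (set_prod G (\<lambda>i. (\<phi> ^^ i) ` F) n))))) \<le> Entp G \<phi>"
    by (simp add: A_def[abs_def])
qed

section \<open>The bound by geometric entropy\<close>

lemma orbit_length_bound:
  fixes a :: "nat \<Rightarrow> nat"
  assumes "limsup (\<lambda>n. ereal (root n (real (a n)))) < ereal \<mu>" "0 < \<mu>"
  shows "\<exists>C. \<forall>n. real (a n) \<le> C * \<mu> ^ n"
proof -
  have "\<forall>\<^sub>F n in sequentially. ereal (root n (real (a n))) < ereal \<mu>"
    by (rule Limsup_lessD[OF assms(1)])
  then obtain N where N: "\<And>n. n \<ge> N \<Longrightarrow> root n (real (a n)) < \<mu>"
    by (auto simp: eventually_sequentially)
  \<comment> \<open>The sum absorbs the finitely many terms up to \<open>N\<close>, including index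
    0, where \<open>root\<close> is not a genuine root; the summand 1 gives \<open>C \<ge> 1\<close>
    for the tail.\<close>
  define C where "C = 1 + (\<Sum>n\<le>N. real (a n) / \<mu> ^ n)"
  have C1: "1 \<le> C" unfolding C_def using assms(2) by (simp add: sum_nonneg)
  have "real (a n) \<le> C * \<mu> ^ n" for n
  proof (cases "n \<le> N")
    case True
    then have "real (a n) / \<mu> ^ n \<le> (\<Sum>n\<le>N. real (a n) / \<mu> ^ n)"
      using assms(2) by (intro member_le_sum) auto
    then have "real (a n) / \<mu> ^ n \<le> C" by (simp add: C_def)
    then show ?thesis using assms(2) by (simp add: divide_le_eq)
  next
    case False
    then have "real (a n) = root n (real (a n)) ^ n" by simp
    also have "\<dots> \<le> \<mu> ^ n" using False N[of n] by (intro power_mono) auto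
    also have "\<dots> \<le> C * \<mu> ^ n" using C1 assms(2) by simp
    finally show ?thesis .
  qed
  then show ?thesis by blast
qed

text \<open>The dimension is bounded by the size of a ball containing all supports, whatever
  \<open>\<delta>\<close> is; only the exponential rate of its radius survives the logarithm divided
  by \<open>n\<close>.\<close>

lemma (in group) Entp_at_le:
  assumes S: "S \<subseteq> carrier G" and gen: "generate G S = carrier G"
    and growth: "polynomial_growth G S r" and r: "0 \<le> r"
    and \<phi>: "\<phi> \<in> carrier G \<rightarrow> carrier G"
    and \<Omega>: "finite \<Omega>" "\<Omega> \<subseteq> Cc G" and \<delta>: "0 < \<delta>" and \<mu>: "1 \<le> \<mu>"
    and orbit: "\<And>g. g \<in> carrier G \<Longrightarrow> \<exists>C. \<forall>n. real (word_length G S ((\<phi> ^^ n) g)) \<le> C * \<mu> ^ n"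
  shows "Entp_at G \<phi> \<Omega> \<delta> \<le> ereal (r * ln \<mu>)"
proof -
  define F where "F = (\<Union>f\<in>\<Omega>. {g. f g \<noteq> 0})"
  have F: "finite F" "F \<subseteq> carrier G" using \<Omega> by (auto simp: F_def Cc_def)
  \<comment> \<open>A sum over \<open>F\<close> in place of a maximum: it dominates each orbit
    length and is still bounded by a multiple of \<open>\<mu> ^ i\<close>.\<close>
  define R where "R i = (\<Sum>g\<in>F. word_length G S ((\<phi> ^^ i) g))" for i
  obtain c where c: "\<And>g n. g \<in> F \<Longrightarrow> real (word_length G S ((\<phi> ^^ n) g)) \<le> c g * \<mu> ^ n"
    using orbit F(2) by (metis subsetD)
  define C where "C = 1 + (\<Sum>g\<in>F. \<bar>c g\<bar>)"
  have C1: "1 \<le> C" by (simp add: C_def sum_nonneg)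
  have R: "real (R i) \<le> C * \<mu> ^ i" for i
  proof -
    have "real (R i) \<le> (\<Sum>g\<in>F. \<bar>c g\<bar> * \<mu> ^ i)"
      unfolding R_def of_nat_sum
      by (intro sum_mono order_trans[OF c] mult_right_mono) (use \<mu> in auto)
    also have "\<dots> \<le> C * \<mu> ^ i"
      using \<mu> by (simp add: C_def sum_distrib_right[symmetric] distrib_right)
    finally show ?thesis .
  qed
  define \<rho> where "\<rho> n = (\<Sum>i<n. R i)" for n
  have \<rho>: "real (\<rho> n) \<le> real n * (C * \<mu> ^ n)" for n
  proof -
    \<comment> \<open>Each \<open>\<mu> ^ i\<close> is replaced by \<open>\<mu> ^ n\<close>, as
      \<open>\<mu> \<ge> 1\<close>. The resulting factor \<open>n\<close> is subexponential, and the
      case \<open>\<mu> = 1\<close> is included.\<close>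
    have "real (\<rho> n) \<le> (\<Sum>i<n. C * \<mu> ^ n)"
      unfolding \<rho>_def of_nat_sum
      by (intro sum_mono order_trans[OF R] mult_left_mono power_increasing) (use \<mu> C1 in auto)
    then show ?thesis by simp
  qed
  define b where "b n = {g \<in> carrier G. word_length G S g \<le> n}" for n
  obtain K where K: "K > 0" "\<And>n. finite (b n)" "\<And>n. real (card (b n)) \<le> K * (1 + real n) powr r"
    using growth unfolding polynomial_growth_def b_def by blast
  have funpow: "(\<phi> ^^ i) g \<in> carrier G" if "g \<in> carrier G" for i g
    using that \<phi> by (induction i) auto
  let ?A = "\<lambda>i. (induced_aut \<phi> ^^ i) ` \<Omega>"
  let ?D = "\<lambda>n. approx_dim (reduced_Cstar G) (left_regular G ` conv_set_prod G ?A n) \<delta>"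
  have A: "{g. f g \<noteq> 0} \<subseteq> {g \<in> carrier G. word_length G S g \<le> R i}" if f: "f \<in> ?A i" for i f
  proof -
    obtain h where h: "h \<in> \<Omega>" "f = (induced_aut \<phi> ^^ i) h" using f by auto
    have "{g. f g \<noteq> 0} \<subseteq> (\<phi> ^^ i) ` F"
      unfolding h by (rule order_trans[OF support_induced_aut_funpow image_mono])
        (use h(1) in \<open>auto simp: F_def\<close>)
    moreover have "word_length G S ((\<phi> ^^ i) g) \<le> R i" if "g \<in> F" for g
      unfolding R_def using that F(1) by (intro member_le_sum) auto
    ultimately show ?thesis using funpow F(2) by blast
  qed
  have D: "?D n \<le> enat (card (b (\<rho> n)))" for n
    using support_conv_set_prod[OF S gen A]
    by (intro approx_dim_le \<delta> K) (auto simp: b_def \<rho>_def)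
  \<comment> \<open>The logarithm of \<open>K * (2 * C * n * \<mu> ^ n) powr r\<close>, divided by
    \<open>n\<close>.\<close>
  define w where "w n = (ln K + r * (ln (2 * C) + ln (real n) + real n * ln \<mu>)) / real n" for n
  have le: "ereal (1 / real n) * ln_ereal (ereal_of_enat (?D n)) \<le> ereal (w n)" if n: "0 < n" for n
  proof -
    have "real (card (b (\<rho> n))) \<le> K * (1 + real (\<rho> n)) powr r" by (rule K)
    also have "\<dots> \<le> K * (2 * C * real n * \<mu> ^ n) powr r"
    proof -
      \<comment> \<open>For \<open>n > 0\<close> the bound on \<open>\<rho> n\<close> is at least 1,
        so the 1 in \<open>1 + \<rho> n\<close> costs only a factor 2.\<close>
      have "1 * 1 \<le> real n * (C * \<mu> ^ n)"
        using n C1 \<mu> by (intro mult_mono mult_ge1_I one_le_power) auto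
      then have "1 + real (\<rho> n) \<le> 2 * C * real n * \<mu> ^ n"
        using \<rho>[of n] by (simp add: algebra_simps)
      then show ?thesis using K(1) r by (intro mult_left_mono powr_mono2) auto
    qed
    also have "\<dots> = exp (ln K + r * (ln (2 * C) + ln (real n) + real n * ln \<mu>))"
      using n C1 \<mu> K(1) by (simp add: powr_def exp_add ln_mult ln_realpow)
    finally have "ereal (real (card (b (\<rho> n))))
        \<le> ereal (exp (ln K + r * (ln (2 * C) + ln (real n) + real n * ln \<mu>)))" by simp
    moreover have "ereal_of_enat (?D n) \<le> ereal (real (card (b (\<rho> n))))"
      using D[of n] by (metis ereal_of_enat_le_iff ereal_of_enat_simps(1))
    ultimately have "ln_ereal (ereal_of_enat (?D n))
        \<le> ln_ereal (ereal (exp (ln K + r * (ln (2 * C) + ln (real n) + real n * ln \<mu>))))"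
      by (intro ln_ereal_mono) (rule order_trans)
    then have "ereal (1 / real n) * ln_ereal (ereal_of_enat (?D n))
        \<le> ereal (1 / real n) * ereal (ln K + r * (ln (2 * C) + ln (real n) + real n * ln \<mu>))"
      by (intro ereal_mult_left_mono) (auto simp: ln_ereal_def)
    then show ?thesis by (simp add: w_def)
  qed
  have "w \<longlonglongrightarrow> r * ln \<mu>"
    unfolding w_def by real_asymp
  then have "limsup (\<lambda>n. ereal (w n)) = ereal (r * ln \<mu>)"
    by (intro lim_imp_Limsup) auto
  moreover have "Entp_at G \<phi> \<Omega> \<delta> \<le> limsup (\<lambda>n. ereal (w n))"
    unfolding Entp_at_def
    by (rule Limsup_mono, rule eventually_mono[OF eventually_gt_at_top[of 0]]) (rule le)
  ultimately show ?thesis by simp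
qed

text \<open>Orbit lengths are bounded by multiples of \<open>\<mu> ^ n\<close> for every
  \<open>\<mu>\<close> above the supremum \<open>s\<close> of the growth rates; when
  \<open>s\<close> is finite, \<open>\<mu>\<close> then decreases to \<open>s\<close>.\<close>

lemma (in group) Entp_le_h_geo:
  assumes inf: "infinite (carrier G)"
    and S: "S \<subseteq> carrier G" and gen: "generate G S = carrier G"
    and growth: "polynomial_growth G S r" and r: "0 < r"
    and \<phi>: "\<phi> \<in> iso G G"
  shows "Entp G \<phi> \<le> ereal r * h_geo G S \<phi>"
proof -
  define L where "L g = limsup (\<lambda>n. ereal (root n (real (word_length G S ((\<phi> ^^ n) g)))))" for g
  define s where "s = (SUP g\<in>carrier G. L g)"
  have \<phi>': "\<phi> \<in> carrier G \<rightarrow> carrier G" "inj_on \<phi> (carrier G)" "\<phi> \<one> = \<one>"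
    using \<phi> hom_one[OF _ is_group is_group, of \<phi>]
    by (auto simp: iso_def hom_def bij_betw_def)
  \<comment> \<open>Infinitude supplies a nontrivial element. By injectivity its orbit never meets
    the identity, so its lengths are at least 1 and \<open>s \<ge> 1\<close>; this permits all
    \<open>\<mu> > s\<close> in \<open>Entp_at_le\<close> and keeps \<open>ln_ereal s\<close> away
    from minus infinity.\<close>
  obtain g where g: "g \<in> carrier G" "g \<noteq> \<one>"
    using inf by (metis finite.emptyI finite_insert finite_subset insertI1 subsetI)
  have orb: "(\<phi> ^^ n) g \<in> carrier G \<and> (\<phi> ^^ n) g \<noteq> \<one>" for n
  proof (induction n)
    case (Suc n)
    with \<phi>' show ?case using inj_onD[OF \<phi>'(2), of "(\<phi> ^^ n) g" \<one>] by auto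
  qed (use g in simp)
  have "1 \<le> L g"
    unfolding L_def
  proof (rule le_Limsup)
    have "1 \<le> root n (real (word_length G S ((\<phi> ^^ n) g)))" if "0 < n" for n
      using word_length_pos[OF S, of "(\<phi> ^^ n) g"] orb[of n] gen that by simp
    then show "\<forall>\<^sub>F n in sequentially. 1 \<le> ereal (root n (real (word_length G S ((\<phi> ^^ n) g))))"
      by (intro eventually_mono[OF eventually_gt_at_top[of 0]]) simp
  qed simp
  then have s1: "1 \<le> s" unfolding s_def using g(1) by (rule SUP_upper2[rotated])
  have geo: "h_geo G S \<phi> = ln_ereal s" by (simp add: h_geo_def s_def L_def)
  show ?thesis
  proof (cases s)
    case PInf
    then show ?thesis using r by (simp add: geo ln_ereal_def)
  next
    case MInf
    then show ?thesis using s1 by simp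
  next
    case (real t)
    have t: "1 \<le> t" using s1 real by simp
    \<comment> \<open>The inequality \<open>t < \<mu>\<close> is strict because an upper limit equal
      to \<open>t\<close> need not give lengths bounded by a multiple of
      \<open>t ^ n\<close>.\<close>
    have bound: "Entp_at G \<phi> \<Omega> \<delta> \<le> ereal (r * ln \<mu>)"
      if "finite \<Omega>" "\<Omega> \<subseteq> Cc G" "0 < \<delta>" "t < \<mu>" for \<Omega> \<delta> \<mu>
    proof (rule Entp_at_le[OF S gen growth _ \<phi>'(1)])
      fix h assume "h \<in> carrier G"
      then have "L h \<le> s" unfolding s_def by (rule SUP_upper)
      also have "\<dots> < ereal \<mu>" using real that by simp
      finally show "\<exists>C. \<forall>n. real (word_length G S ((\<phi> ^^ n) h)) \<le> C * \<mu> ^ n"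
        unfolding L_def using t that by (intro orbit_length_bound) auto
    qed (use that t r in auto)
    have "Entp_at G \<phi> \<Omega> \<delta> \<le> ereal (r * ln t)"
      if "finite \<Omega>" "\<Omega> \<subseteq> Cc G" "0 < \<delta>" for \<Omega> \<delta>
    \<comment> \<open>The value at \<open>t\<close> follows by letting \<open>\<mu>\<close> decrease
      to \<open>t\<close>, by continuity of \<open>ln\<close> at \<open>t \<ge> 1\<close>.\<close>
    proof (rule tendsto_lowerbound)
      have "((\<lambda>\<mu>. r * ln \<mu>) \<longlongrightarrow> r * ln t) (at_right t)"
        using t by (intro tendsto_intros) auto
      then show "((\<lambda>\<mu>. ereal (r * ln \<mu>)) \<longlongrightarrow> ereal (r * ln t)) (at_right t)" by simp
      show "\<forall>\<^sub>F \<mu> in at_right t. Entp_at G \<phi> \<Omega> \<delta> \<le> ereal (r * ln \<mu>)"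
        using bound[OF that] by (auto simp: eventually_at_filter)
    qed simp
    then have "Entp G \<phi> \<le> ereal (r * ln t)"
      unfolding Entp_def by (auto simp: Cc_unit_ball_def intro!: SUP_least)
    then show ?thesis using real t by (simp add: geo ln_ereal_def)
  qed
qed

theorem mainTheorem1:
  fixes G :: "('a, 'b) monoid_scheme" and S :: "'a set" and \<phi> :: "'a \<Rightarrow> 'a" and r :: real
  assumes "group G"
    and "infinite (carrier G)"
    and "finite S" and "S \<subseteq> carrier G" and "generate G S = carrier G"
    and "r \<ge> 1" and "polynomial_growth G S r"
    and "\<phi> \<in> iso G G"
  shows "h_alg G \<phi> \<le> Entp G \<phi> \<and> Entp G \<phi> \<le> ereal r * h_geo G S \<phi>"
proof
  interpret group G by fact
  show "h_alg G \<phi> \<le> Entp G \<phi>"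
    by (rule h_alg_le_Entp) (use assms in \<open>auto simp: iso_def hom_def\<close>)
  show "Entp G \<phi> \<le> ereal r * h_geo G S \<phi>"
    by (rule Entp_le_h_geo) (use assms in auto)
qed

end
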